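(* There is a function $t \colon \mathbb{Z}_{\geq 1} \to \mathbb{Z}_{\geq 1}$ with $t(d) = 3\mathrm{e}\, d\,(1+o(1))$ as $d \to \infty$ such that the following holds. Let $d$ and $m$ be positive integers and let $\mathcal{R}_{\text{ST}}$ be the range family of all axis-aligned strips in $\mathbb{R}^d$. Then, for every finite point set $V \subset \mathbb{R}^d$ in general position, the hypergraph $\mathcal{H}(V, \mathcal{R}_{\text{ST}}, m)$ admits a $t(d)$-shallow hitting set.
   Context: A range family is a family $\mathcal{R}$ of subsets of $\mathbb{R}^d$. The family of all axis-aligned strips in $\mathbb{R}^d$ is $\mathcal{R}_{\text{ST}} = \mathcal{R}_{\text{ST}}^1 \cup \cdots \cup \mathcal{R}_{\text{ST}}^d$ with $\mathcal{R}_{\text{ST}}^i = \{ \{(x_1,\ldots,x_d) \in \mathbb{R}^d \mid a \leq x_i \leq b\} \mid a,b \in \mathbb{R}\}$. For a finite point set $V \subset \mathbb{R}^d$ and a positive integer $m$, $\mathcal{H}(V,\mathcal{R},m)$ is the hypergraph with vertex set $V$ whose hyperedges are exactly the subsets $e \subseteq V$ with $|e| = m$ for which there is some $R \in \mathcal{R}$ with $e = V \cap R$. General position means that distinct points of $V$ have pairwise different $i$-th coordinates for every $i$. For a hypergraph with vertex set $V$ and hyperedge set $E$ and a positive integer $t$, a $t$-shallow hitting set is a subset $X \subseteq V$ with $1 \leq |e \cap X| \leq t$ for every $e \in E$. Here $\mathrm{e} = 2.71828\ldots$ is Euler's number, and $t(d)$ depends only on $d$ (not on $m$ or $V$). *)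

theory Defs
  imports "HOL-Library.FuncSet" "HOL-Library.Landau_Symbols" Complex_Main
begin

text \<open>
  The dimension is quantified inside the theorem (the bound depends on it), so
  points of \<open>d\<close>-dimensional space are extensional functions on the index set
  \<open>{1..d}\<close>: they are \<open>undefined\<close> elsewhere, so equality of points is equality of
  all \<open>d\<close> coordinates.
\<close>

type_synonym point = "nat \<Rightarrow> real"

definition Rspace :: "nat \<Rightarrow> point set" where
  "Rspace d = ({1..d} \<rightarrow>\<^sub>E (UNIV :: real set))"

definition strips_dir :: "nat \<Rightarrow> nat \<Rightarrow> point set set" where
  "strips_dir d i = {{x \<in> Rspace d. a \<le> x i \<and> x i \<le> b} | a b :: real. True}"

definition strips :: "nat \<Rightarrow> point set set" where
  "strips d = (\<Union>i\<in>{1..d}. strips_dir d i)"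

definition general_position :: "nat \<Rightarrow> point set \<Rightarrow> bool" where
  "general_position d V \<longleftrightarrow>
     (\<forall>p\<in>V. \<forall>q\<in>V. p \<noteq> q \<longrightarrow> (\<forall>i\<in>{1..d}. p i \<noteq> q i))"

type_synonym 'a hypergraph = "'a set \<times> 'a set set"

definition range_hypergraph :: "'a set \<Rightarrow> 'a set set \<Rightarrow> nat \<Rightarrow> 'a hypergraph" where
  "range_hypergraph V \<R> m =
     (V, {e. e \<subseteq> V \<and> card e = m \<and> (\<exists>R\<in>\<R>. e = V \<inter> R)})"

definition shallow_hitting_set :: "nat \<Rightarrow> 'a hypergraph \<Rightarrow> 'a set \<Rightarrow> bool" where
  "shallow_hitting_set t H X \<longleftrightarrow>
     X \<subseteq> fst H \<and> (\<forall>e\<in>snd H. 1 \<le> card (e \<inter> X) \<and> card (e \<inter> X) \<le> t)"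

end

theory Submission
  imports Defs
begin

text \<open>
  A strip in direction \<open>i\<close> that contains exactly \<open>m\<close> points of \<open>V\<close> contains \<open>m\<close>
  consecutive points in the order of \<open>V\<close> by the \<open>i\<close>-th coordinate. Cut each of the \<open>d\<close>
  coordinate orders into consecutive blocks of \<open>k = \<lceil>m/2\<rceil>\<close> points, where only the last
  block may be shorter. Then \<open>m\<close> consecutive points contain a full block, since
  \<open>2k - 1 \<le> m\<close>, and meet at most three blocks, since \<open>m \<le> 2k\<close>. So it suffices to
  find a set \<open>X\<close> of points that meets every full block and has at most \<open>s\<close> points in every
  block: such a set is \<open>3s\<close>-shallow hitting (lemma \<open>shallow_hitting_rankings\<close>).

  To hit the full blocks, let each of them choose one of its own \<open>k\<close> points. The problem is
  to keep the number of chosen points in a block below a bound that depends on \<open>d\<close> only,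
  although \<open>k\<close> grows with \<open>m\<close>. This is the setting of the Lovasz Local Lemma, which is
  replaced here by Rosenfeld's counting argument: call a choice for a set \<open>S\<close> of full blocks
  admissible if no block contains more than \<open>s\<close> chosen points. If one more block \<open>u\<close>
  chooses, an extension by \<open>p \<in> u\<close> fails only if some block \<open>b\<close> that contains \<open>p\<close> already
  contains \<open>s\<close> chosen points. There are at most \<open>k d\<close> pairs \<open>(p, b)\<close>, at most
  \<open>(k choose s) \<le> k^s / s!\<close> sets of \<open>s\<close> points of \<open>b\<close>, and at most \<open>d^s\<close> ways to name
  the blocks that chose them, because a point lies in only \<open>d\<close> blocks. Forgetting these
  \<open>s\<close> blocks leaves an admissible choice for a smaller set. If every earlier step multiplied
  the number of admissible choices by at least \<open>x k\<close>, there are \<open>(x k)^s\<close> times fewer of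
  those. The powers \<open>k^s\<close> cancel, which makes the bound independent of \<open>m\<close>, and the number
  keeps growing by the factor \<open>x k\<close> provided that
  \<open>d^(s+1) \<le> s! x^s (1 - x)\<close> (lemma \<open>admissible_growth\<close>).

  With \<open>x = s/(s+1)\<close> and \<open>s! \<ge> (s/e)^s\<close> this condition follows from
  \<open>e (s+1) d \<le> (s/(e d))^s\<close>. The right-hand side is at least \<open>exp (s - e d)\<close>, so any
  excess of \<open>s\<close> over \<open>e d\<close> that is large compared with \<open>ln d\<close> suffices for large \<open>d\<close>; the choice is
  \<open>s = \<lceil>e d + 4 sqrt d\<rceil>\<close> (lemma \<open>load_condition\<close>). Hence \<open>3s = 3 e d (1 + o(1))\<close>.
\<close>

section \<open>Counting admissible choices\<close>

text \<open>
  The index set \<open>B\<close> stands for all blocks, and \<open>F\<close> for those that have to be hit. In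
  geometric terms \<open>F\<close> consists of the full blocks and \<open>B - F\<close> of the last, incomplete block
  of each order. Blocks in \<open>B - F\<close> choose no point but are subject to the upper bound too.
\<close>

locale block_system =
  fixes B F :: "'b set" and P :: "'b \<Rightarrow> 'a set" and k r s :: nat
  assumes finite_B: "finite B"
    and F_sub: "F \<subseteq> B"
    and finite_P: "\<And>b. b \<in> B \<Longrightarrow> finite (P b)"
    and card_P_le: "\<And>b. b \<in> B \<Longrightarrow> card (P b) \<le> k"
    and card_P_eq: "\<And>b. b \<in> F \<Longrightarrow> card (P b) = k"
    and card_incident: "\<And>p. card {b \<in> B. p \<in> P b} \<le> r"
    and k_pos: "0 < k"
begin

definition admissible :: "'b set \<Rightarrow> ('b \<Rightarrow> 'a) set" where
  "admissible S = {f \<in> PiE S P. \<forall>b\<in>B. card (P b \<inter> f ` S) \<le> s}"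

definition saturating :: "'b set \<Rightarrow> 'b \<Rightarrow> ('b \<Rightarrow> 'a) set" where
  "saturating S b = {g \<in> admissible S. card (P b \<inter> g ` S) = s}"

abbreviation N :: "'b set \<Rightarrow> real" where
  "N S \<equiv> real (card (admissible S))"

lemma finite_admissible:
  assumes "S \<subseteq> F"
  shows "finite (admissible S)"
proof -
  have "finite S"
    using assms F_sub finite_B by (meson finite_subset)
  then have "finite (PiE S P)"
    using assms F_sub finite_P by (intro finite_PiE) auto
  then show ?thesis
    by (rule rev_finite_subset) (auto simp: admissible_def)
qed

lemma restrict_admissible:
  assumes "f \<in> admissible S" "S' \<subseteq> S"
  shows "restrict f S' \<in> admissible S'"
proof -
  have "card (P b \<inter> restrict f S' ` S') \<le> s" if "b \<in> B" for b
  proof -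
    have "card (P b \<inter> restrict f S' ` S') \<le> card (P b \<inter> f ` S)"
      using assms(2) finite_P[OF that] by (intro card_mono) auto
    also have "\<dots> \<le> s"
      using assms(1) that by (auto simp: admissible_def)
    finally show ?thesis .
  qed
  moreover have "restrict f S' \<in> PiE S' P"
    using assms by (auto simp: admissible_def PiE_def Pi_def)
  ultimately show ?thesis
    by (simp add: admissible_def)
qed

text \<open>
  Prescribing the choices of the blocks \<open>h ` C\<close> leaves only the freedom of the others, whose
  choices are admissible by themselves.
\<close>

lemma card_prescribed_le:
  assumes S: "S \<subseteq> F" and h: "h ` C \<subseteq> S"
  shows "card {g \<in> admissible S. \<forall>c\<in>C. g (h c) = c} \<le> card (admissible (S - h ` C))"
proof (rule card_inj_on_le)
  let ?G = "{g \<in> admissible S. \<forall>c\<in>C. g (h c) = c}"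
  show "inj_on (\<lambda>g. restrict g (S - h ` C)) ?G"
  proof (rule inj_onI)
    fix f g
    assume f: "f \<in> ?G" and g: "g \<in> ?G"
      and eq: "restrict f (S - h ` C) = restrict g (S - h ` C)"
    show "f = g"
    proof (rule PiE_ext)
      show "f \<in> PiE S P" "g \<in> PiE S P"
        using f g by (auto simp: admissible_def)
      fix x
      assume x: "x \<in> S"
      show "f x = g x"
      proof (cases "x \<in> h ` C")
        case True
        then show ?thesis using f g by auto
      next
        case False
        then show ?thesis using fun_cong[OF eq, of x] x by simp
      qed
    qed
  qed
  show "(\<lambda>g. restrict g (S - h ` C)) ` ?G \<subseteq> admissible (S - h ` C)"
    by (auto intro: restrict_admissible)
  show "finite (admissible (S - h ` C))"
    using S by (intro finite_admissible) auto
qed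

text \<open>
  A choice that saturates \<open>b\<close> is encoded by three data: the set \<open>C\<close> of its chosen points in
  \<open>b\<close>, for each of them a block \<open>h c\<close> that chose it, and the choices of the remaining blocks.
  The function \<open>h\<close> is injective, since a block chooses only one point, so exactly \<open>s\<close> blocks
  are removed.
\<close>

lemma card_saturating_le:
  assumes S: "S \<subseteq> F" and b: "b \<in> B"
    and M: "\<And>D. D \<subseteq> S \<Longrightarrow> card D = s \<Longrightarrow> N (S - D) \<le> M"
    and M0: "0 \<le> M"
  shows "real (card (saturating S b)) \<le> real k ^ s / fact s * real r ^ s * M"
proof -
  define \<C> where "\<C> = {C. C \<subseteq> P b \<and> card C = s}"
  define H where "H C = PiE C (\<lambda>c. {b \<in> B. c \<in> P b})" for C
  define H' where "H' C = {h \<in> H C. inj_on h C \<and> h ` C \<subseteq> S}" for C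
  define G where "G C h = {g \<in> admissible S. \<forall>c\<in>C. g (h c) = c}" for C h
  have fin\<C>: "finite \<C>"
    unfolding \<C>_def using finite_P[OF b] by simp
  have finC: "finite C" if "C \<in> \<C>" for C
    using that finite_P[OF b] by (auto simp: \<C>_def intro: finite_subset)
  have finH: "finite (H C)" if "C \<in> \<C>" for C
    unfolding H_def using finC[OF that] finite_B by (intro finite_PiE) auto
  have finH': "finite (H' C)" if "C \<in> \<C>" for C
    using finH[OF that] by (auto simp: H'_def)
  have finG: "finite (G C h)" for C h
    using finite_admissible[OF S] by (auto simp: G_def)
  have cardH: "real (card (H' C)) \<le> real r ^ s" if "C \<in> \<C>" for C
  proof -
    have "card (H' C) \<le> card (H C)"
      using finH[OF that] by (intro card_mono) (auto simp: H'_def)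
    also have "\<dots> = (\<Prod>c\<in>C. card {b \<in> B. c \<in> P b})"
      unfolding H_def using finC[OF that] by (simp add: card_PiE)
    also have "\<dots> \<le> (\<Prod>c\<in>C. r)"
      by (intro prod_mono) (auto intro: card_incident)
    also have "\<dots> = r ^ s"
      using that by (simp add: \<C>_def)
    finally show ?thesis
      by (metis of_nat_le_iff of_nat_power)
  qed
  have cover: "saturating S b \<subseteq> (\<Union>C\<in>\<C>. \<Union>h\<in>H' C. G C h)"
  proof
    fix g
    assume "g \<in> saturating S b"
    then have g: "g \<in> admissible S" and gs: "card (P b \<inter> g ` S) = s"
      by (auto simp: saturating_def)
    define C where "C = P b \<inter> g ` S"
    define h where "h = restrict (inv_into S g) C"
    have gh: "g (h c) = c" and hS: "h c \<in> S" if "c \<in> C" for c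
      using that by (auto simp: h_def C_def f_inv_into_f inv_into_into)
    have "h c \<in> B \<and> c \<in> P (h c)" if "c \<in> C" for c
    proof -
      have "g (h c) \<in> P (h c)"
        using g hS[OF that] by (auto simp: admissible_def)
      then show ?thesis
        using gh[OF that] hS[OF that] S F_sub by auto
    qed
    then have "h \<in> H C"
      unfolding H_def by (auto simp: h_def)
    moreover have "inj_on h C"
      by (rule inj_on_inverseI[where g = g]) (rule gh)
    ultimately have "h \<in> H' C"
      using hS by (auto simp: H'_def)
    moreover have "C \<in> \<C>"
      using gs by (auto simp: \<C>_def C_def)
    moreover have "g \<in> G C h"
      using g gh by (auto simp: G_def)
    ultimately show "g \<in> (\<Union>C\<in>\<C>. \<Union>h\<in>H' C. G C h)"
      by auto
  qed
  have cardG: "real (card (G C h)) \<le> M" if C: "C \<in> \<C>" and h: "h \<in> H' C" for C h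
  proof -
    have hS: "h ` C \<subseteq> S" and "card (h ` C) = s"
      using C h by (auto simp: H'_def \<C>_def card_image)
    then have "N (S - h ` C) \<le> M"
      by (intro M)
    then show ?thesis
      using card_prescribed_le[OF S hS] unfolding G_def by linarith
  qed
  have "card (saturating S b) \<le> card (\<Union>C\<in>\<C>. \<Union>h\<in>H' C. G C h)"
    using fin\<C> finH' finG by (intro card_mono cover) auto
  also have "\<dots> \<le> (\<Sum>C\<in>\<C>. card (\<Union>h\<in>H' C. G C h))"
    by (rule card_UN_le[OF fin\<C>])
  also have "\<dots> \<le> (\<Sum>C\<in>\<C>. \<Sum>h\<in>H' C. card (G C h))"
    by (intro sum_mono card_UN_le finH')
  finally have "real (card (saturating S b)) \<le> real (\<Sum>C\<in>\<C>. \<Sum>h\<in>H' C. card (G C h))"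
    by linarith
  also have "\<dots> = (\<Sum>C\<in>\<C>. \<Sum>h\<in>H' C. real (card (G C h)))"
    by simp
  also have "\<dots> \<le> (\<Sum>C\<in>\<C>. \<Sum>h\<in>H' C. M)"
    by (intro sum_mono cardG)
  also have "\<dots> \<le> (\<Sum>C\<in>\<C>. real r ^ s * M)"
    using cardH M0 by (intro sum_mono) (simp add: mult_right_mono)
  also have "\<dots> = real (card (P b) choose s) * (real r ^ s * M)"
    using finite_P[OF b] by (simp add: \<C>_def n_subsets)
  also have "\<dots> \<le> real k ^ s / fact s * (real r ^ s * M)"
  proof (intro mult_right_mono)
    have "(card (P b) choose s) * fact s \<le> card (P b) ^ s"
      by (rule binomial_fact_pow)
    also have "\<dots> \<le> k ^ s"
      using card_P_le[OF b] by (intro power_mono) auto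
    finally have "real ((card (P b) choose s) * fact s) \<le> real (k ^ s)"
      by (rule of_nat_mono)
    then show "real (card (P b) choose s) \<le> real k ^ s / fact s"
      by (simp add: field_simps)
  qed (use M0 in simp)
  finally show ?thesis
    by (simp add: mult.assoc)
qed

lemma extend_admissible:
  assumes g: "g \<in> admissible S" and u: "u \<in> F" "u \<notin> S" and p: "p \<in> P u"
    and ns: "\<And>b. b \<in> B \<Longrightarrow> p \<in> P b \<Longrightarrow> g \<notin> saturating S b"
  shows "g(u := p) \<in> admissible (insert u S)"
proof -
  have img: "(g(u := p)) ` insert u S = insert p (g ` S)"
    using u by auto
  have "card (P b \<inter> insert p (g ` S)) \<le> s" if b: "b \<in> B" for b
  proof (cases "p \<in> P b")
    case True
    have "card (P b \<inter> g ` S) \<le> s" "card (P b \<inter> g ` S) \<noteq> s"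
      using g b ns[OF b True] by (auto simp: admissible_def saturating_def)
    moreover have "card (insert p (P b \<inter> g ` S)) \<le> Suc (card (P b \<inter> g ` S))"
      by (rule card_insert_le_m1) auto
    ultimately show ?thesis
      using True by simp
  next
    case False
    then show ?thesis
      using g b by (auto simp: admissible_def)
  qed
  moreover have "g(u := p) \<in> PiE (insert u S) P"
    using g p u by (auto simp: admissible_def PiE_def extensional_def)
  ultimately show ?thesis
    unfolding admissible_def mem_Collect_eq img by blast
qed

text \<open>
  Among the \<open>k\<close> extensions of each admissible choice to \<open>u\<close>, those that fail are counted by
  a point \<open>p\<close> of \<open>u\<close>, a block \<open>b\<close> through \<open>p\<close> and a choice that saturates \<open>b\<close>.
\<close>

lemma one_step_count:
  assumes S: "S \<subseteq> F" and u: "u \<in> F" "u \<notin> S"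
    and L: "\<And>b. b \<in> B \<Longrightarrow> real (card (saturating S b)) \<le> L" and L0: "0 \<le> L"
  shows "real k * N S \<le> N (insert u S) + real k * real r * L"
proof -
  define Q where "Q = (\<Union>p\<in>P u. \<Union>b\<in>{b \<in> B. p \<in> P b}. saturating S b \<times> {p})"
  define G where "G = admissible S \<times> P u - Q"
  have finPu: "finite (P u)"
    using u F_sub finite_P by auto
  have finA: "finite (admissible S)"
    by (rule finite_admissible[OF S])
  have finsat: "finite (saturating S b)" for b
    using finA by (auto simp: saturating_def)
  have finQ: "finite Q"
    unfolding Q_def using finPu finite_B finsat by auto
  have "card Q \<le> (\<Sum>p\<in>P u. card (\<Union>b\<in>{b \<in> B. p \<in> P b}. saturating S b \<times> {p}))"
    unfolding Q_def by (rule card_UN_le[OF finPu])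
  also have "\<dots> \<le> (\<Sum>p\<in>P u. \<Sum>b\<in>{b \<in> B. p \<in> P b}. card (saturating S b \<times> {p}))"
    using finite_B by (intro sum_mono card_UN_le) auto
  finally have "real (card Q) \<le>
      real (\<Sum>p\<in>P u. \<Sum>b\<in>{b \<in> B. p \<in> P b}. card (saturating S b \<times> {p}))"
    by linarith
  also have "\<dots> = (\<Sum>p\<in>P u. \<Sum>b\<in>{b \<in> B. p \<in> P b}. real (card (saturating S b)))"
    by (simp add: card_cartesian_product)
  also have "\<dots> \<le> (\<Sum>p\<in>P u. \<Sum>b\<in>{b \<in> B. p \<in> P b}. L)"
    by (intro sum_mono L) auto
  also have "\<dots> \<le> (\<Sum>p\<in>P u. real r * L)"
    using L0 card_incident by (intro sum_mono) (simp add: mult_right_mono)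
  also have "\<dots> = real k * real r * L"
    using card_P_eq[OF u(1)] by simp
  finally have cardQ: "real (card Q) \<le> real k * real r * L" .
  have "card G \<le> card (admissible (insert u S))"
  proof (rule card_inj_on_le)
    show "inj_on (\<lambda>(g, p). g(u := p)) G"
    proof (rule inj_onI, clarify)
      fix f p g q
      assume fp: "(f, p) \<in> G" and gq: "(g, q) \<in> G" and eq: "f(u := p) = g(u := q)"
      have "f \<in> PiE S P" "g \<in> PiE S P"
        using fp gq by (auto simp: G_def admissible_def)
      moreover have "f x = g x" if "x \<in> S" for x
        using fun_cong[OF eq, of x] that u by (auto split: if_splits)
      ultimately have "f = g"
        by (rule PiE_ext)
      moreover have "p = q"
        using fun_cong[OF eq, of u] by simp
      ultimately show "f = g \<and> p = q" ..
    qed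
    show "(\<lambda>(g, p). g(u := p)) ` G \<subseteq> admissible (insert u S)"
      using u by (auto simp: G_def Q_def intro!: extend_admissible)
    show "finite (admissible (insert u S))"
      using S u by (intro finite_admissible) auto
  qed
  moreover have "card (admissible S \<times> P u) \<le> card G + card Q"
  proof -
    have "card (admissible S \<times> P u) \<le> card (G \<union> Q)"
      using finA finPu finQ by (intro card_mono) (auto simp: G_def)
    also have "\<dots> \<le> card G + card Q"
      by (rule card_Un_le)
    finally show ?thesis .
  qed
  ultimately have "real (card (admissible S \<times> P u)) \<le> N (insert u S) + real (card Q)"
    by linarith
  then show ?thesis
    using cardQ card_P_eq[OF u(1)] by (simp add: card_cartesian_product mult.commute)
qed

text \<open>
  This is the core of the counting argument. By the induction hypothesis for smaller sets,
  removing \<open>s\<close> blocks divides the number of admissible choices by at least \<open>(x k)^s\<close>. This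
  turns the bound on failing extensions into a multiple of \<open>N S\<close>, and the condition on \<open>x\<close>
  says that this multiple is at most \<open>k (1 - x)\<close>.
\<close>

lemma admissible_growth:
  fixes x :: real
  assumes x: "0 < x" and cond: "real r ^ Suc s \<le> fact s * x ^ s * (1 - x)"
    and S: "S \<subseteq> F" and u: "u \<in> F" "u \<notin> S"
  shows "x * real k * N S \<le> N (insert u S)"
  using S u
proof (induction "card S" arbitrary: S u rule: less_induct)
  case less
  note S = less.prems(1) and u = less.prems(2,3)
  define \<beta> where "\<beta> = x * real k"
  have \<beta>: "0 < \<beta>"
    using x k_pos by (simp add: \<beta>_def)
  have finS: "finite S"
    using S F_sub finite_B by (meson finite_subset)
  have remove: "\<beta> ^ card D * N (S - D) \<le> N S" if "D \<subseteq> S" for D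
  proof -
    have "finite D"
      using that finS by (rule finite_subset)
    then show ?thesis
      using that
    proof (induction D)
      case empty
      then show ?case by simp
    next
      case (insert v D)
      have "card (S - insert v D) < card S"
        using insert.prems finS by (intro psubset_card_mono) auto
      then have "\<beta> * N (S - insert v D) \<le> N (insert v (S - insert v D))"
        unfolding \<beta>_def using insert.prems S by (intro less.hyps) auto
      moreover have "insert v (S - insert v D) = S - D"
        using insert by auto
      ultimately have "\<beta> ^ card D * (\<beta> * N (S - insert v D)) \<le> \<beta> ^ card D * N (S - D)"
        using \<beta> by (intro mult_left_mono) auto
      also have "\<dots> \<le> N S"
        using insert by auto
      finally show ?case
        using insert.hyps by (simp add: mult_ac)
    qed
  qed
  define M where "M = N S / \<beta> ^ s"
  have M0: "0 \<le> M"
    using \<beta> by (simp add: M_def)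
  have M: "N (S - D) \<le> M" if "D \<subseteq> S" "card D = s" for D
    using remove[OF that(1)] that(2) \<beta> by (simp add: M_def field_simps)
  define L where "L = real k ^ s / fact s * real r ^ s * M"
  have "real k * N S \<le> N (insert u S) + real k * real r * L"
  proof (rule one_step_count[OF S u])
    show "real (card (saturating S b)) \<le> L" if "b \<in> B" for b
      unfolding L_def using S that M M0 by (rule card_saturating_le)
  qed (use M0 in \<open>simp add: L_def\<close>)
  moreover have "real k * real r * L \<le> real k * (1 - x) * N S"
  proof -
    have "real r * L = real r ^ Suc s / (fact s * x ^ s) * N S"
      using x k_pos by (simp add: L_def M_def \<beta>_def power_mult_distrib field_simps)
    also have "\<dots> \<le> (1 - x) * N S"
      using cond x by (intro mult_right_mono) (auto simp: field_simps)
    finally have "real k * (real r * L) \<le> real k * ((1 - x) * N S)"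
      by (intro mult_left_mono) auto
    then show ?thesis
      by (simp add: mult_ac)
  qed
  ultimately show ?case
    by (simp add: algebra_simps)
qed

lemma exists_admissible:
  fixes x :: real
  assumes x: "0 < x" and cond: "real r ^ Suc s \<le> fact s * x ^ s * (1 - x)"
  shows "\<exists>f \<in> PiE F P. \<forall>b\<in>B. card (P b \<inter> f ` F) \<le> s"
proof -
  have "finite F"
    using F_sub finite_B by (rule finite_subset)
  then have "0 < N F"
  proof (rule finite_subset_induct'[where A = F])
    show "0 < N {}"
      by (simp add: admissible_def)
  next
    fix u S
    assume "u \<in> F" "S \<subseteq> F" "u \<notin> S" and pos: "0 < N S"
    then have "x * real k * N S \<le> N (insert u S)"
      by (intro admissible_growth[OF x cond])
    moreover have "0 < x * real k * N S"
      using x k_pos pos by simp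
    ultimately show "0 < N (insert u S)"
      by linarith
  qed simp
  then have "admissible F \<noteq> {}"
    by auto
  then show ?thesis
    by (auto simp: admissible_def)
qed

end

section \<open>Several rankings of one finite set\<close>

lemma interval_div_le_three:
  fixes a k m q :: nat
  assumes "0 < k" "m \<le> 2 * k" "a \<le> q" "q < a + m"
  shows "q div k \<in> {a div k, a div k + 1, a div k + 2}"
proof -
  have "q div k \<le> (a + 2 * k) div k"
    using assms by (intro div_le_mono) auto
  also have "\<dots> = a div k + 2"
    using assms(1) by simp
  finally have "q div k \<le> a div k + 2" .
  moreover have "a div k \<le> q div k"
    using assms by (intro div_le_mono) auto
  ultimately show ?thesis
    by auto
qed

text \<open>
  The blocks are indexed by pairs \<open>(i, j)\<close>: block \<open>j\<close> of ranking \<open>i\<close> contains the points of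
  ranks \<open>j k, \<dots>, j k + k - 1\<close>. Each point lies in one block per ranking, hence in at most
  \<open>card I\<close> blocks.
\<close>

lemma shallow_hitting_rankings:
  fixes \<rho> :: "'i \<Rightarrow> 'a \<Rightarrow> nat" and x :: real
  assumes fin: "finite V" and finI: "finite I" and m: "0 < m"
    and \<rho>: "\<And>i. i \<in> I \<Longrightarrow> bij_betw (\<rho> i) V {..<card V}"
    and x: "0 < x" and cond: "real (card I) ^ Suc s \<le> fact s * x ^ s * (1 - x)"
  shows "\<exists>X\<subseteq>V. \<forall>i\<in>I. \<forall>a. a + m \<le> card V \<longrightarrow>
           1 \<le> card {p \<in> X. a \<le> \<rho> i p \<and> \<rho> i p < a + m} \<and>
           card {p \<in> X. a \<le> \<rho> i p \<and> \<rho> i p < a + m} \<le> 3 * s"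
proof -
  define n where "n = card V"
  define k where "k = (m + 1) div 2"
  have k: "0 < k" "m \<le> 2 * k" "2 * k \<le> m + 1"
    using m by (auto simp: k_def)
  define P where "P = (\<lambda>(i, j). {p \<in> V. \<rho> i p div k = j})"
  define B where "B = I \<times> {..n}"
  define F where "F = {(i, j) \<in> B. j * k + k \<le> n}"
  have lt: "\<rho> i p < n" if "i \<in> I" "p \<in> V" for i p
    using \<rho>[OF that(1)] that(2) by (auto simp: bij_betw_def n_def)
  have img: "\<rho> i ` P (i, j) = {j * k ..< j * k + k} \<inter> {..<n}" if "i \<in> I" for i j
  proof -
    have "q div k = j \<longleftrightarrow> j * k \<le> q \<and> q < j * k + k" for q
      using k(1) by (metis add.commute div_nat_eqI div_times_less_eq_dividend dividend_less_div_times mult_Suc mult.commute)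
    then have "\<rho> i ` P (i, j) = {q \<in> \<rho> i ` V. j * k \<le> q \<and> q < j * k + k}"
      by (auto simp: P_def)
    then show ?thesis
      using \<rho>[OF that] by (auto simp: bij_betw_def n_def)
  qed
  have cardP: "card (P (i, j)) = card ({j * k ..< j * k + k} \<inter> {..<n})" if "i \<in> I" for i j
  proof -
    have "inj_on (\<rho> i) (P (i, j))"
      using \<rho>[OF that] by (auto simp: bij_betw_def P_def intro: inj_on_subset)
    then show ?thesis
      using card_image img[OF that] by metis
  qed
  interpret block_system B F P k "card I" s
  proof
    show "finite B" "F \<subseteq> B" "0 < k"
      using finI k by (auto simp: B_def F_def)
    show "finite (P b)" if "b \<in> B" for b
      using fin by (auto simp: P_def split: prod.splits)
    show "card (P b) \<le> k" if bB: "b \<in> B" for b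
    proof -
      obtain i j where b: "b = (i, j)" "i \<in> I"
        using bB by (auto simp: B_def)
      have "card ({j * k ..< j * k + k} \<inter> {..<n}) \<le> card {j * k ..< j * k + k}"
        by (intro card_mono) auto
      then show ?thesis
        using b cardP by simp
    qed
    show "card (P b) = k" if bF: "b \<in> F" for b
    proof -
      obtain i j where b: "b = (i, j)" "i \<in> I" "j * k + k \<le> n"
        using bF by (auto simp: B_def F_def)
      then have "{j * k ..< j * k + k} \<inter> {..<n} = {j * k ..< j * k + k}"
        by auto
      then show ?thesis
        using b cardP by simp
    qed
    show "card {b \<in> B. p \<in> P b} \<le> card I" for p
    proof -
      have "card {b \<in> B. p \<in> P b} \<le> card ((\<lambda>i. (i, \<rho> i p div k)) ` I)"
        using finI by (intro card_mono) (auto simp: B_def P_def)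
      also have "\<dots> \<le> card I"
        using finI by (rule card_image_le)
      finally show ?thesis .
    qed
  qed
  obtain f where f: "f \<in> PiE F P" and load: "\<And>b. b \<in> B \<Longrightarrow> card (P b \<inter> f ` F) \<le> s"
    using exists_admissible[OF x cond] by blast
  define X where "X = f ` F"
  have XV: "X \<subseteq> V"
    using f by (auto simp: X_def P_def PiE_def Pi_def split: prod.splits)
  moreover have "1 \<le> card {p \<in> X. a \<le> \<rho> i p \<and> \<rho> i p < a + m} \<and>
           card {p \<in> X. a \<le> \<rho> i p \<and> \<rho> i p < a + m} \<le> 3 * s"
    if i: "i \<in> I" and a: "a + m \<le> n" for i a
  proof
    let ?E = "{p \<in> X. a \<le> \<rho> i p \<and> \<rho> i p < a + m}"
    have finX: "finite X"
      using XV fin by (rule finite_subset)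
    \<comment> \<open>The first block that starts at or after \<open>a\<close>, so \<open>j = \<lceil>a/k\<rceil>\<close>; it ends at
        rank \<open>a + 2k - 2\<close> or earlier, hence inside the interval.\<close>
    define j where "j = (a + k - 1) div k"
    have jk: "a \<le> j * k" "j * k \<le> a + k - 1"
    proof -
      show "j * k \<le> a + k - 1"
        by (simp add: j_def)
      have "a + k - 1 < j * k + k"
        unfolding j_def using dividend_less_div_times[OF k(1), of "a + k - 1"] by linarith
      then show "a \<le> j * k"
        using k(1) by linarith
    qed
    have jn: "j * k + k \<le> n" and jm: "j * k + k \<le> a + m"
      using jk a k by linarith+
    have "j * 1 \<le> j * k"
      using k(1) by (intro mult_le_mono) auto
    then have "j \<le> n"
      using jn by linarith
    then have "(i, j) \<in> F"
      using i jn by (auto simp: F_def B_def)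
    then have "f (i, j) \<in> X" "f (i, j) \<in> P (i, j)"
      using f by (auto simp: X_def)
    moreover have "j * k \<le> \<rho> i (f (i, j))" "\<rho> i (f (i, j)) < j * k + k"
      using img[OF i, of j] \<open>f (i, j) \<in> P (i, j)\<close> by auto
    ultimately have "f (i, j) \<in> ?E"
      using jk jm by auto
    then have "card ?E \<noteq> 0"
      using finX by auto
    then show "1 \<le> card ?E"
      by simp
    let ?J = "{a div k, a div k + 1, a div k + 2}"
    \<comment> \<open>The indices in \<open>?J\<close> may exceed \<open>n\<close>; the corresponding blocks are empty.\<close>
    have blk: "card (P (i, j) \<inter> X) \<le> s" for j
    proof (cases "j \<le> n")
      case True
      then show ?thesis
        using load i by (simp add: B_def X_def)
    next
      case False
      have "n < j * k"
        using False k(1) by (metis less_le_trans mult.right_neutral mult_le_mono2 not_le Suc_leI One_nat_def)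
      then have "{j * k ..< j * k + k} \<inter> {..<n} = {}"
        by auto
      then have "card (P (i, j)) = 0"
        using cardP[OF i, of j] by simp
      then have "P (i, j) = {}"
        using fin by (auto simp: P_def)
      then show ?thesis
        by simp
    qed
    have "?E \<subseteq> (\<Union>j\<in>?J. P (i, j) \<inter> X)"
    proof
      fix p
      assume p: "p \<in> ?E"
      then have "\<rho> i p div k \<in> ?J"
        using k by (intro interval_div_le_three) auto
      moreover have "p \<in> P (i, \<rho> i p div k) \<inter> X"
        using p XV by (auto simp: P_def)
      ultimately show "p \<in> (\<Union>j\<in>?J. P (i, j) \<inter> X)"
        by blast
    qed
    then have "card ?E \<le> card (\<Union>j\<in>?J. P (i, j) \<inter> X)"
      using finX by (intro card_mono) auto
    also have "\<dots> \<le> (\<Sum>j\<in>?J. card (P (i, j) \<inter> X))"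
      by (intro card_UN_le) auto
    also have "\<dots> \<le> (\<Sum>j\<in>?J. s)"
      by (intro sum_mono blk)
    also have "\<dots> = 3 * s"
      by simp
    finally show "card ?E \<le> 3 * s" .
  qed
  ultimately show ?thesis
    unfolding n_def by blast
qed

section \<open>Coordinate rankings and strips\<close>

definition coord_rank :: "point set \<Rightarrow> nat \<Rightarrow> point \<Rightarrow> nat" where
  "coord_rank V i p = card {q \<in> V. q i < p i}"

lemma coord_rank_less_iff:
  assumes "finite V" "p \<in> V"
  shows "coord_rank V i p < coord_rank V i q \<longleftrightarrow> p i < q i"
proof
  assume "p i < q i"
  then show "coord_rank V i p < coord_rank V i q"
    unfolding coord_rank_def using assms by (intro psubset_card_mono) auto
next
  assume *: "coord_rank V i p < coord_rank V i q"
  show "p i < q i"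
  proof (rule ccontr)
    assume "\<not> p i < q i"
    then have "coord_rank V i q \<le> coord_rank V i p"
      unfolding coord_rank_def using assms by (intro card_mono) auto
    with * show False by simp
  qed
qed

lemma bij_betw_coord_rank:
  assumes fin: "finite V" and gp: "general_position d V" and i: "i \<in> {1..d}"
  shows "bij_betw (coord_rank V i) V {..<card V}"
proof -
  have inj: "inj_on (coord_rank V i) V"
  proof (rule inj_onI, rule ccontr)
    fix p q
    assume pq: "p \<in> V" "q \<in> V" "coord_rank V i p = coord_rank V i q" "p \<noteq> q"
    then have "p i \<noteq> q i"
      using gp i by (auto simp: general_position_def)
    then show False
      using coord_rank_less_iff[OF fin, of p i q] coord_rank_less_iff[OF fin, of q i p] pq by auto
  qed
  have "coord_rank V i p < card V" if "p \<in> V" for p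
    unfolding coord_rank_def using fin that by (intro psubset_card_mono) auto
  then have "coord_rank V i ` V \<subseteq> {..<card V}"
    by auto
  then have "coord_rank V i ` V = {..<card V}"
    using inj by (intro card_subset_eq) (auto simp: card_image)
  with inj show ?thesis
    by (simp add: bij_betw_def)
qed

lemma nat_order_convex_interval:
  fixes T :: "nat set"
  assumes fin: "finite T" and ne: "T \<noteq> {}"
    and conv: "\<And>x y z. x \<in> T \<Longrightarrow> z \<in> T \<Longrightarrow> x \<le> y \<Longrightarrow> y \<le> z \<Longrightarrow> y \<in> T"
  obtains a where "T = {a ..< a + card T}"
proof
  have "T = {Min T .. Max T}"
  proof (intro equalityI subsetI)
    fix y
    assume "y \<in> {Min T .. Max T}"
    then show "y \<in> T"
      using conv[OF Min_in[OF fin ne] Max_in[OF fin ne], of y] by simp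
  qed (use fin in simp)
  then have T: "T = {Min T ..< Suc (Max T)}"
    by (simp add: atLeastLessThanSuc_atLeastAtMost)
  then have "card T = Suc (Max T) - Min T"
    by (metis card_atLeastLessThan)
  moreover have "Min T \<le> Suc (Max T)"
    using fin ne by (simp add: le_SucI)
  ultimately show "T = {Min T ..< Min T + card T}"
    using T by simp
qed

text \<open>
  The ranks of the points in a strip form an order-convex set: a point of \<open>V\<close> whose rank lies
  between the ranks of two points of the strip has its coordinate between theirs.
\<close>

lemma strip_is_rank_interval:
  assumes fin: "finite V" and VR: "V \<subseteq> Rspace d" and gp: "general_position d V"
    and i: "i \<in> {1..d}" and R: "R \<in> strips_dir d i" and ne: "V \<inter> R \<noteq> {}"
  obtains a where "a + card (V \<inter> R) \<le> card V"
    and "V \<inter> R = {p \<in> V. a \<le> coord_rank V i p \<and> coord_rank V i p < a + card (V \<inter> R)}"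
proof -
  let ?\<rho> = "coord_rank V i" and ?e = "V \<inter> R"
  obtain \<alpha> \<beta> where "R = {x \<in> Rspace d. \<alpha> \<le> x i \<and> x i \<le> \<beta>}"
    using R by (auto simp: strips_dir_def)
  then have e: "?e = {p \<in> V. \<alpha> \<le> p i \<and> p i \<le> \<beta>}"
    using VR by auto
  have inj: "inj_on ?\<rho> V" and img: "?\<rho> ` V = {..<card V}"
    using bij_betw_coord_rank[OF fin gp i] by (auto simp: bij_betw_def)
  have le: "p i \<le> q i" if "p \<in> V" "q \<in> V" "?\<rho> p \<le> ?\<rho> q" for p q
    using coord_rank_less_iff[OF fin that(2), of i p] that(3) by auto
  have conv: "y \<in> ?\<rho> ` ?e" if x: "x \<in> ?\<rho> ` ?e" and z: "z \<in> ?\<rho> ` ?e" and y: "x \<le> y" "y \<le> z" for x y z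
  proof -
    obtain p q where p: "p \<in> ?e" "x = ?\<rho> p" and q: "q \<in> ?e" "z = ?\<rho> q"
      using x z by auto
    have "z < card V"
      using q img by auto
    then have "y \<in> ?\<rho> ` V"
      using y img by auto
    then obtain v where v: "v \<in> V" "y = ?\<rho> v"
      by auto
    have "p i \<le> v i" "v i \<le> q i"
      using p q v y by (auto intro!: le)
    then have "v \<in> ?e"
      using p(1) q(1) v(1) unfolding e by auto
    then show ?thesis
      using v by auto
  qed
  have "finite (?\<rho> ` ?e)" "?\<rho> ` ?e \<noteq> {}"
    using fin ne by auto
  then obtain a where "?\<rho> ` ?e = {a ..< a + card (?\<rho> ` ?e)}"
    using nat_order_convex_interval conv by metis
  moreover have "card (?\<rho> ` ?e) = card ?e"
    using inj by (intro card_image) (auto intro: inj_on_subset)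
  ultimately have a: "?\<rho> ` ?e = {a ..< a + card ?e}"
    by simp
  show thesis
  proof
    have "card ?e > 0"
      using fin ne by (simp add: card_gt_0_iff)
    then have "a + card ?e - 1 \<in> ?\<rho> ` ?e"
      unfolding a by auto
    then have "a + card ?e - 1 < card V"
      using img by auto
    then show "a + card ?e \<le> card V"
      by simp
    have "p \<in> ?e \<longleftrightarrow> ?\<rho> p \<in> ?\<rho> ` ?e" if "p \<in> V" for p
      using inj_on_image_mem_iff[OF inj that, of ?e] by auto
    then show "?e = {p \<in> V. a \<le> ?\<rho> p \<and> ?\<rho> p < a + card ?e}"
      unfolding a by auto
  qed
qed

lemma strips_shallow_hitting_set:
  fixes x :: real
  assumes fin: "finite V" and VR: "V \<subseteq> Rspace d" and gp: "general_position d V" and m: "0 < m"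
    and x: "0 < x" and cond: "real d ^ Suc s \<le> fact s * x ^ s * (1 - x)"
  shows "\<exists>X. shallow_hitting_set (3 * s) (range_hypergraph V (strips d) m) X"
proof -
  have "\<exists>X\<subseteq>V. \<forall>i\<in>{1..d}. \<forall>a. a + m \<le> card V \<longrightarrow>
           1 \<le> card {p \<in> X. a \<le> coord_rank V i p \<and> coord_rank V i p < a + m} \<and>
           card {p \<in> X. a \<le> coord_rank V i p \<and> coord_rank V i p < a + m} \<le> 3 * s"
    using bij_betw_coord_rank[OF fin gp] x cond
    by (intro shallow_hitting_rankings[OF fin _ m, where x = x]) auto
  then obtain X where XV: "X \<subseteq> V"
    and X: "\<And>i a. i \<in> {1..d} \<Longrightarrow> a + m \<le> card V \<Longrightarrow>
           1 \<le> card {p \<in> X. a \<le> coord_rank V i p \<and> coord_rank V i p < a + m} \<and>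
           card {p \<in> X. a \<le> coord_rank V i p \<and> coord_rank V i p < a + m} \<le> 3 * s"
    by blast
  have "1 \<le> card (e \<inter> X) \<and> card (e \<inter> X) \<le> 3 * s"
    if e: "card e = m" "R \<in> strips d" "e = V \<inter> R" for e R
  proof -
    obtain i where i: "i \<in> {1..d}" "R \<in> strips_dir d i"
      using e by (auto simp: strips_def)
    have ne: "V \<inter> R \<noteq> {}"
      using e m by auto
    obtain a where a: "a + m \<le> card V"
      "e = {p \<in> V. a \<le> coord_rank V i p \<and> coord_rank V i p < a + m}"
      using strip_is_rank_interval[OF fin VR gp i ne, folded e(3), unfolded e(1)] by blast
    have "e \<inter> X = {p \<in> X. a \<le> coord_rank V i p \<and> coord_rank V i p < a + m}"
      using a(2) XV by auto
    then show ?thesis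
      using X[OF i(1) a(1)] by simp
  qed
  then have "shallow_hitting_set (3 * s) (range_hypergraph V (strips d) m) X"
    using XV by (auto simp: shallow_hitting_set_def range_hypergraph_def)
  then show ?thesis ..
qed

section \<open>The load bound and its asymptotics\<close>

text \<open>
  The term \<open>4 sqrt d\<close> is a convenient quantity that is at least \<open>1 + ln ((s + 1) d)\<close> for all
  \<open>d \<ge> 1\<close> and is still \<open>o(d)\<close>.
\<close>

definition load :: "nat \<Rightarrow> nat" where
  "load d = nat \<lceil>exp 1 * real d + 4 * sqrt (real d)\<rceil>"

lemma load_bounds:
  "exp 1 * real d + 4 * sqrt (real d) \<le> real (load d)"
  "real (load d) \<le> exp 1 * real d + 4 * sqrt (real d) + 1"
proof -
  have "0 \<le> exp 1 * real d + 4 * sqrt (real d)"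
    by simp
  then show "exp 1 * real d + 4 * sqrt (real d) \<le> real (load d)"
    "real (load d) \<le> exp 1 * real d + 4 * sqrt (real d) + 1"
    unfolding load_def by linarith+
qed

lemma power_self_div_fact_le_exp:
  "real n ^ n / fact n \<le> exp (real n)"
proof -
  have "(\<Sum>i\<in>{n}. inverse (fact i) *\<^sub>R real n ^ i) \<le> (\<Sum>i. inverse (fact i) *\<^sub>R real n ^ i)"
    by (rule sum_le_suminf[OF summable_exp_generic]) auto
  then show ?thesis
    by (simp add: exp_def divide_inverse mult.commute)
qed

text \<open>
  Write \<open>s\<close> for the load and \<open>q\<close> for \<open>sqrt d\<close>. The proof multiplies three estimates:
  \<open>(e d/s)^s \<le> exp (e d - s) \<le> exp (-4q)\<close>, the crude bound
  \<open>(s + 1) d \<le> 9 q^4 \<le> exp (4q - 1)\<close>, and \<open>x^s = (1 + 1/s)^(-s) \<ge> exp (-1)\<close>.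
\<close>

lemma load_condition:
  assumes d: "d \<ge> 1"
  defines "x \<equiv> real (load d) / (real (load d) + 1)"
  shows "0 < x" and "real d ^ Suc (load d) \<le> fact (load d) * x ^ load d * (1 - x)"
proof -
  define s where "s = load d"
  define q where "q = sqrt (real d)"
  have q1: "1 \<le> q" and dq: "real d = q ^ 2"
    using d by (auto simp: q_def)
  have lo: "exp 1 * real d + 4 * q \<le> real s" and hi: "real s \<le> exp 1 * real d + 4 * q + 1"
    using load_bounds[of d] by (auto simp: s_def q_def)
  have s0: "0 < real s"
    using lo q1 by (smt (verit) exp_gt_zero mult_nonneg_nonneg of_nat_0_le_iff)
  then show "0 < x"
    by (simp add: x_def s_def)
  have x: "x = real s / (real s + 1)"
    by (simp add: x_def s_def)
  have small: "(real s + 1) * real d \<le> exp (4 * q - 1)"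
  proof -
    have "q * 1 \<le> q * q"
      using q1 by (intro mult_left_mono) auto
    then have qd: "q \<le> real d" "1 \<le> real d"
      using dq q1 unfolding power2_eq_square by linarith+
    have "exp 1 * real d \<le> 3 * real d"
      using exp_le by (intro mult_right_mono) auto
    then have "real s + 1 \<le> 9 * real d"
      using hi qd by linarith
    then have "(real s + 1) * real d \<le> (9 * real d) * real d"
      by (intro mult_right_mono) auto
    also have "\<dots> = 9 * q ^ 4"
      using dq by (simp add: power2_eq_square power4_eq_xxxx)
    also have "\<dots> \<le> exp 3 * exp (q - 1) ^ 4"
    proof (intro mult_mono power_mono)
      have "(9::real) \<le> (1 + 3/2 + (3/2)^2 / 2)^2"
        by (simp add: power2_eq_square)
      also have "\<dots> \<le> exp (3/2) ^ 2"
        by (intro power_mono exp_lower_Taylor_quadratic) auto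
      also have "\<dots> = exp 3"
        by (simp flip: exp_of_nat_mult)
      finally show "(9::real) \<le> exp 3" .
      show "q \<le> exp (q - 1)"
        using exp_ge_add_one_self[of "q - 1"] by simp
    qed (use q1 in auto)
    also have "\<dots> = exp (4 * q - 1)"
      by (simp flip: exp_of_nat_mult exp_add)
    finally show ?thesis .
  qed
  have ratio: "(exp 1 * real d / real s) ^ s \<le> exp (- 4 * q)"
  proof -
    have "(exp 1 * real d / real s) ^ s \<le> exp (exp 1 * real d / real s - 1) ^ s"
      using exp_ge_add_one_self[of "exp 1 * real d / real s - 1"] by (intro power_mono) auto
    also have "\<dots> = exp (exp 1 * real d - real s)"
      using s0 by (simp add: right_diff_distrib flip: exp_of_nat_mult)
    also have "\<dots> \<le> exp (- 4 * q)"
      using lo by simp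
    finally show ?thesis .
  qed
  have xs: "exp (- 1) \<le> x ^ s"
  proof -
    have "(1 + 1 / real s) ^ s \<le> exp (1 / real s) ^ s"
      by (intro power_mono exp_ge_add_one_self) auto
    also have "\<dots> = exp 1"
      using s0 by (simp flip: exp_of_nat_mult)
    finally have "inverse (exp 1) \<le> inverse ((1 + 1 / real s) ^ s)"
      using s0 by (intro le_imp_inverse_le) (auto intro!: zero_less_power add_pos_pos)
    also have "\<dots> = x ^ s"
      using s0 by (simp add: x field_simps flip: power_inverse)
    finally show ?thesis
      by (simp add: exp_minus)
  qed
  have "real d ^ Suc s * (real s + 1) = (exp 1 * real d / real s) ^ s * ((real s + 1) * real d) * (real s ^ s / exp (real s))"
    using s0 by (simp add: power_divide power_mult_distrib field_simps flip: exp_of_nat_mult)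
  also have "\<dots> \<le> exp (- 4 * q) * exp (4 * q - 1) * (real s ^ s / exp (real s))"
    by (intro mult_right_mono mult_mono ratio small) auto
  also have "\<dots> = exp (- 1) * (real s ^ s / exp (real s))"
    by (simp flip: exp_add)
  also have "\<dots> \<le> x ^ s * fact s"
  proof (intro mult_mono xs)
    show "real s ^ s / exp (real s) \<le> fact s"
      using power_self_div_fact_le_exp[of s] by (simp add: field_simps)
  qed (use \<open>0 < x\<close> in auto)
  finally have "real d ^ Suc s \<le> fact s * x ^ s * (1 / (real s + 1))"
    using s0 by (simp add: field_simps)
  also have "1 / (real s + 1) = 1 - x"
    using s0 by (simp add: x field_simps)
  finally show "real d ^ Suc (load d) \<le> fact (load d) * x ^ load d * (1 - x)"
    by (simp add: s_def)
qed

lemma load_asymptotics: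
  "(\<lambda>d. real (load d) / (exp 1 * real d) - 1) \<in> o[at_top](\<lambda>_. 1)"
proof -
  have sqrt_inv: "(\<lambda>d. 1 / sqrt (real d)) \<longlonglongrightarrow> 0"
    by (intro tendsto_divide_0[OF tendsto_const] filterlim_at_top_imp_at_infinity
          filterlim_compose[OF sqrt_at_top filterlim_real_sequentially])
  have bound: "norm (real (load d) / (exp 1 * real d) - 1) \<le> 5 * (1 / sqrt (real d))"
    if d: "d \<ge> 1" for d
  proof -
    define q where "q = sqrt (real d)"
    have q1: "1 \<le> q" and dq: "real d = q * q"
      using d by (auto simp: q_def)
    have e1: "(1::real) \<le> exp 1"
      by simp
    have pos: "0 < exp 1 * real d"
      using d by simp
    have "real (load d) - exp 1 * real d \<le> 5 * q" "0 \<le> real (load d) - exp 1 * real d"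
      using load_bounds[of d] q1 by (auto simp: q_def[symmetric])
    moreover have "5 * q \<le> exp 1 * (5 * q)"
      using e1 q1 mult_right_mono[OF e1, of "5 * q"] by simp
    moreover have "real (load d) / (exp 1 * real d) - 1 = (real (load d) - exp 1 * real d) / (exp 1 * real d)"
      using d by (simp add: diff_divide_distrib)
    ultimately have "norm (real (load d) / (exp 1 * real d) - 1) \<le> exp 1 * (5 * q) / (exp 1 * real d)"
      using pos by (simp only: real_norm_def abs_of_nonneg divide_nonneg_pos) (intro divide_right_mono; linarith)
    also have "\<dots> = 5 * (1 / q)"
      using q1 by (simp add: dq)
    finally show ?thesis
      by (simp add: q_def)
  qed
  have "(\<lambda>d. real (load d) / (exp 1 * real d) - 1) \<longlonglongrightarrow> 0"
  proof (rule tendsto_0_le[OF sqrt_inv, where K = 5])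
    show "\<forall>\<^sub>F d in sequentially.
        norm (real (load d) / (exp 1 * real d) - 1) \<le> norm (1 / sqrt (real d)) * 5"
      using bound by (intro eventually_sequentiallyI[of 1]) simp
  qed
  then show ?thesis
    by (intro smalloI_tendsto) auto
qed

theorem theorem5:
  "\<exists>t :: nat \<Rightarrow> nat.
     (\<forall>d\<ge>1. t d \<ge> 1) \<and>
     (\<exists>\<epsilon> :: nat \<Rightarrow> real. \<epsilon> \<in> o[at_top](\<lambda>_. 1) \<and>
        (\<forall>d\<ge>1. real (t d) = 3 * exp 1 * real d * (1 + \<epsilon> d))) \<and>
     (\<forall>(d::nat) (m::nat) (V :: point set).
        d \<ge> 1 \<longrightarrow> m \<ge> 1 \<longrightarrow> finite V \<longrightarrow> V \<subseteq> Rspace d \<longrightarrow> general_position d V \<longrightarrow>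
        (\<exists>X. shallow_hitting_set (t d) (range_hypergraph V (strips d) m) X))"
proof (intro exI[of _ "\<lambda>d. 3 * load d"] conjI)
  show "\<forall>d\<ge>1. 3 * load d \<ge> 1"
  proof (intro allI impI)
    fix d :: nat
    assume "d \<ge> 1"
    then have "load d \<noteq> 0"
      using load_condition(1)[of d] by (intro notI) simp
    then show "3 * load d \<ge> 1"
      by simp
  qed
  show "\<exists>\<epsilon> :: nat \<Rightarrow> real. \<epsilon> \<in> o[at_top](\<lambda>_. 1) \<and>
      (\<forall>d\<ge>1. real (3 * load d) = 3 * exp 1 * real d * (1 + \<epsilon> d))"
    using load_asymptotics
    by (intro exI[of _ "\<lambda>d. real (load d) / (exp 1 * real d) - 1"]) auto
  show "\<forall>(d::nat) (m::nat) (V :: point set).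
      d \<ge> 1 \<longrightarrow> m \<ge> 1 \<longrightarrow> finite V \<longrightarrow> V \<subseteq> Rspace d \<longrightarrow> general_position d V \<longrightarrow>
      (\<exists>X. shallow_hitting_set (3 * load d) (range_hypergraph V (strips d) m) X)"
    using load_condition by (auto intro!: strips_shallow_hitting_set)
qed

end
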